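(* Fix real numbers $\varphi_0<\varphi_1$, fix $\rho\in M$, and for each $\varepsilon\in(0,\varepsilon_0)$, $\varepsilon_0=1/(\varphi_1-\varphi_0)$, let $\varphi_\varepsilon\in\mathscr F_\varepsilon(\rho)$. If $\varepsilon_n\downarrow0$ is a sequence such that $\varphi_{\varepsilon_n}\to\varphi$ in $\mathcal F$ for some $\varphi\in\mathcal F$, then $\varphi$ is a minimizer of $\mathcal G(\rho,\cdot)$ over $\mathcal F$.
   Context: $M=\{\rho\in L^\infty([0,1]):0\le\rho\le1\}$. $\mathcal F$ is the set of functions $\varphi:[0,1]\to\mathbb R$ of the form $\varphi(x)=\varphi_0+\mu([0,x])$ with $\mu=d\varphi$ a positive Borel measure on $[0,1]$ of total mass $\varphi_1-\varphi_0$; $\varphi^n\to\varphi$ in $\mathcal F$ means $\int g\,d\varphi^n\to\int g\,d\varphi$ for every continuous $g$ on $[0,1]$. $s(a)=a\log a+(1-a)\log(1-a)$ for $a\in[0,1]$ (with $0\log0=0$), $s(a)=+\infty$ otherwise. $$\mathcal G_\varepsilon(\rho,\varphi)=\int_0^1\big[s(\rho)+s(\varepsilon\varphi_x)+(1-\rho)\varphi-\log(1+e^\varphi)\big]dx,$$ with $\mathcal G_\varepsilon(\rho,\varphi)=+\infty$ unless $d\varphi$ is absolutely continuous with respect to Lebesgue measure with density $\varphi_x$ bounded by $\varepsilon^{-1}$; $$\mathcal G(\rho,\varphi)=\int_0^1\big[s(\rho)+(1-\rho)\varphi-\log(1+e^\varphi)\big]dx.$$ $\mathscr F_\varepsilon(\rho)$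 is the (non-empty) set of minimizers of $\mathcal G_\varepsilon(\rho,\cdot)$ over $\mathcal F$. *)

theory Defs
  imports "HOL-Analysis.Analysis"
begin

text \<open>Elements of \<open>L\<^sup>\<infinity>([0,1])\<close> are given by representatives; values outside \<open>[0,1]\<close> are irrelevant,
  here and for the functions in \<open>\<F>\<close> below.\<close>

definition M_set :: "(real \<Rightarrow> real) set" where
  "M_set = {\<rho> \<in> borel_measurable (lebesgue_on {0..1}). AE x in lebesgue_on {0..1}. 0 \<le> \<rho> x \<and> \<rho> x \<le> 1}"

abbreviation borel01 :: "real measure" where
  "borel01 \<equiv> restrict_space borel {0..1}"

abbreviation lborel01 :: "real measure" where
  "lborel01 \<equiv> restrict_space lborel {0..1}"

text \<open>\<open>\<mu>\<close> may have an atom at \<open>0\<close>, of mass \<open>\<phi>(0) - \<phi>\<^sub>0\<close>; therefore \<open>d\<phi>\<close> depends on \<open>\<phi>\<^sub>0\<close>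
  as well as on \<open>\<phi>\<close>.\<close>

definition has_measure :: "real \<Rightarrow> (real \<Rightarrow> real) \<Rightarrow> real measure \<Rightarrow> bool" where
  "has_measure \<phi>0 \<phi> \<mu> \<longleftrightarrow>
     finite_measure \<mu> \<and> sets \<mu> = sets borel01 \<and> (\<forall>x\<in>{0..1}. \<phi> x = \<phi>0 + measure \<mu> {0..x})"

definition F_set :: "real \<Rightarrow> real \<Rightarrow> (real \<Rightarrow> real) set" where
  "F_set \<phi>0 \<phi>1 = {\<phi>. \<exists>\<mu>. has_measure \<phi>0 \<phi> \<mu> \<and> measure \<mu> {0..1} = \<phi>1 - \<phi>0}"

definition dmeas :: "real \<Rightarrow> (real \<Rightarrow> real) \<Rightarrow> real measure" where
  "dmeas \<phi>0 \<phi> = (THE \<mu>. has_measure \<phi>0 \<phi> \<mu>)"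

lemma has_measure_unique:
  assumes "has_measure \<phi>0 \<phi> \<mu>" "has_measure \<phi>0 \<phi> \<nu>"
  shows "\<mu> = \<nu>"
proof -
  interpret m: finite_measure \<mu> using assms(1) by (simp add: has_measure_def)
  interpret n: finite_measure \<nu> using assms(2) by (simp add: has_measure_def)
  have sm: "sets \<mu> = sets borel01" and sn: "sets \<nu> = sets borel01"
    using assms by (auto simp: has_measure_def)
  let ?E = "(\<lambda>x. {0..x}) ` {0..1::real}"
  have sp: "space borel01 = {0..1::real}" by (simp add: space_restrict_space)
  have E_Pow: "?E \<subseteq> Pow {0..1}" by auto
  have E_sub: "?E \<subseteq> sets borel01"
    by (auto simp: sets_restrict_space_iff)
  have gen: "sets borel01 = sigma_sets {0..1} ?E"
  proof
    show "sigma_sets {0..1} ?E \<subseteq> sets borel01"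
      using sets.sigma_sets_subset[OF E_sub] sp by simp
    have b: "sets (borel::real measure) = sigma_sets UNIV (range (\<lambda>a. {..a}))"
      by (metis borel_eq_atMost sets_measure_of subset_UNIV Pow_UNIV full_SetCompr_eq)
    have "sets borel01 = (\<inter>) {0..1} ` sigma_sets UNIV (range (\<lambda>a::real. {..a}))"
      by (simp only: sets_restrict_space b)
    also have "\<dots> = sigma_sets {0..1} ((\<inter>) {0..1} ` range (\<lambda>a::real. {..a}))"
      by (rule sigma_sets_Int) (simp_all flip: b)
    also have "\<dots> \<subseteq> sigma_sets {0..1} ?E"
    proof (rule sigma_sets_mono, clarify)
      fix a :: real
      consider "a < 0" | "0 \<le> a" "a \<le> 1" | "1 < a" by linarith
      then show "{0..1} \<inter> {..a} \<in> sigma_sets {0..1} ?E"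
      proof cases
        case 1
        then have "{0..1} \<inter> {..a} = {}" by auto
        then show ?thesis by (metis sigma_sets.Empty)
      next
        case 2
        then have "{0..1} \<inter> {..a} = {0..a}" by auto
        then show ?thesis using 2 by auto
      next
        case 3
        then have "{0..1} \<inter> {..a} = {0..1}" by auto
        then show ?thesis by (metis sigma_sets_top)
      qed
    qed
    finally show "sets borel01 \<subseteq> sigma_sets {0..1} ?E" .
  qed
  show ?thesis
  proof (rule measure_eqI_generator_eq[where E = ?E and \<Omega> = "{0..1}" and A = "\<lambda>_. {0..1}"])
    show "Int_stable ?E"
      unfolding Int_stable_def
    proof (intro ballI)
      fix A B assume "A \<in> ?E" "B \<in> ?E"
      then obtain a b where "A = {0..a}" "B = {0..b}" "a \<in> {0..1}" "b \<in> {0..1}" by blast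
      then have "A \<inter> B = {0..min a b}" "min a b \<in> {0..1}" by auto
      then show "A \<inter> B \<in> ?E" by blast
    qed
    show "emeasure \<mu> X = emeasure \<nu> X" if "X \<in> ?E" for X
      using that assms
      by (auto simp: has_measure_def m.emeasure_eq_measure n.emeasure_eq_measure)
    show "sets \<mu> = sigma_sets {0..1} ?E" "sets \<nu> = sigma_sets {0..1} ?E"
      using sm sn gen by auto
  qed (auto simp: m.emeasure_eq_measure)
qed

lemma dmeas_eq: "has_measure \<phi>0 \<phi> \<mu> \<Longrightarrow> dmeas \<phi>0 \<phi> = \<mu>"
  unfolding dmeas_def by (blast intro: has_measure_unique)

definition F_conv :: "real \<Rightarrow> (nat \<Rightarrow> real \<Rightarrow> real) \<Rightarrow> (real \<Rightarrow> real) \<Rightarrow> bool" where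
  "F_conv \<phi>0 \<phi>s \<phi> \<longleftrightarrow> (\<forall>g::real \<Rightarrow> real. continuous_on {0..1} g \<longrightarrow>
     (\<lambda>n. \<integral>x. g x \<partial>(dmeas \<phi>0 (\<phi>s n))) \<longlonglongrightarrow> (\<integral>x. g x \<partial>(dmeas \<phi>0 \<phi>)))"

text \<open>The convention \<open>0 log 0 = 0\<close> holds because the product is \<open>0\<close> whatever the value of \<open>ln 0\<close>.\<close>

definition s_ent :: "real \<Rightarrow> ereal" where
  "s_ent a = (if 0 \<le> a \<and> a \<le> 1 then ereal (a * ln a + (1 - a) * ln (1 - a)) else \<infinity>)"

text \<open>Integral of an extended-real function as the difference of the integrals of its positive and
  negative parts (\<open>e2ennreal\<close> truncates negative values to \<open>0\<close>).\<close>

definition ext_integral :: "'a measure \<Rightarrow> ('a \<Rightarrow> ereal) \<Rightarrow> ereal" where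
  "ext_integral N f =
     enn2ereal (\<integral>\<^sup>+x. e2ennreal (f x) \<partial>N) - enn2ereal (\<integral>\<^sup>+x. e2ennreal (- f x) \<partial>N)"

lemma ext_integral_eq_integral:
  assumes "integrable N f"
  shows "ext_integral N (\<lambda>x. ereal (f x)) = ereal (integral\<^sup>L N f)"
proof -
  have fin: "(\<integral>\<^sup>+x. ennreal (f x) \<partial>N) \<noteq> \<infinity>" "(\<integral>\<^sup>+x. ennreal (- f x) \<partial>N) \<noteq> \<infinity>"
    using assms by (auto simp: real_integrable_def)
  have "enn2ereal y = ereal (enn2real y)" if "y \<noteq> \<infinity>" for y
    using that by (cases y) auto
  then show ?thesis
    using fin by (simp add: ext_integral_def real_lebesgue_integral_def[OF assms] flip: ennreal.abs_eq)
qed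

definition density_x :: "real \<Rightarrow> (real \<Rightarrow> real) \<Rightarrow> real \<Rightarrow> real" where
  "density_x \<phi>0 \<phi> x = enn2real (RN_deriv lborel01 (dmeas \<phi>0 \<phi>) x)"

definition G_eps :: "real \<Rightarrow> real \<Rightarrow> (real \<Rightarrow> real) \<Rightarrow> (real \<Rightarrow> real) \<Rightarrow> ereal" where
  "G_eps \<phi>0 \<epsilon> \<rho> \<phi> =
     (if absolutely_continuous lborel01 (dmeas \<phi>0 \<phi>) \<and>
         (AE x in lborel01. density_x \<phi>0 \<phi> x \<le> 1 / \<epsilon>)
      then ext_integral (lebesgue_on {0..1})
             (\<lambda>x. s_ent (\<rho> x) + s_ent (\<epsilon> * density_x \<phi>0 \<phi> x) + ereal ((1 - \<rho> x) * \<phi> x - ln (1 + exp (\<phi> x))))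
      else \<infinity>)"

definition G_lim :: "(real \<Rightarrow> real) \<Rightarrow> (real \<Rightarrow> real) \<Rightarrow> ereal" where
  "G_lim \<rho> \<phi> = ext_integral (lebesgue_on {0..1})
     (\<lambda>x. s_ent (\<rho> x) + ereal ((1 - \<rho> x) * \<phi> x - ln (1 + exp (\<phi> x))))"

definition F_eps_min :: "real \<Rightarrow> real \<Rightarrow> real \<Rightarrow> (real \<Rightarrow> real) \<Rightarrow> (real \<Rightarrow> real) set" where
  "F_eps_min \<phi>0 \<phi>1 \<epsilon> \<rho> = {\<phi>. is_arg_min (G_eps \<phi>0 \<epsilon> \<rho>) (\<lambda>\<psi>. \<psi> \<in> F_set \<phi>0 \<phi>1) \<phi>}"

end

theory Submission
  imports Defs "HOL-Real_Asymp.Real_Asymp"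
begin

text \<open>The entropy term of \<open>G_eps\<close> lies between \<open>bin_entropy (\<epsilon> (\<phi>1 - \<phi>0))\<close> (Jensen) and \<open>0\<close>, so it
  vanishes as \<open>\<epsilon>\<close> tends to \<open>0\<close>. Comparing a minimizer of \<open>G_eps\<close> with a competitor \<open>\<psi>\<close> of bounded
  density, which is admissible for small \<open>\<epsilon>\<close>, gives \<open>G_lim \<rho> \<phi> \<le> G_lim \<rho> \<psi>\<close>, because weak convergence
  implies pointwise convergence off the countably many atoms of the limit and \<open>G_lim\<close> is
  continuous under bounded almost everywhere convergence. By the same continuity the inequality
  passes to all \<open>\<psi>\<close>, since the functions with bounded density are dense.\<close>

section \<open>Real-valued binary entropy and its tangent lines\<close>

definition bin_entropy :: "real \<Rightarrow> real" where
  "bin_entropy a = a * ln a + (1 - a) * ln (1 - a)"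

lemma s_ent_eq: "0 \<le> a \<Longrightarrow> a \<le> 1 \<Longrightarrow> s_ent a = ereal (bin_entropy a)"
  by (simp add: s_ent_def bin_entropy_def)

lemma measurable_bin_entropy [measurable]: "bin_entropy \<in> borel_measurable borel"
  unfolding bin_entropy_def[abs_def] by measurable

lemma bin_entropy_nonpos:
  assumes "0 \<le> a" "a \<le> 1"
  shows "bin_entropy a \<le> 0"
proof -
  have "a * ln a \<le> 0" if "0 \<le> a" "a \<le> 1" for a :: real
    using that by (cases "a = 0") (auto simp: mult_le_0_iff)
  from this[of a] this[of "1 - a"] show ?thesis
    using assms by (simp add: bin_entropy_def)
qed

text \<open>The left side is the tangent of \<open>x * ln x\<close> at \<open>b\<close>, so this is
  convexity. It comes from \<open>ln t \<le> t - 1\<close> at \<open>t = b / a\<close>, which forces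
  \<open>a = 0\<close> to be treated apart.\<close>

lemma xlnx_ge:
  fixes a b :: real
  assumes "0 \<le> a" "0 < b"
  shows "a * ln b + (a - b) \<le> a * ln a"
proof (cases "a = 0")
  case False
  then have a: "0 < a" using assms by simp
  have "ln (b / a) \<le> b / a - 1"
    by (rule ln_le_minus_one) (use a assms in auto)
  then have "a * ln (b / a) \<le> a * (b / a - 1)"
    using a by (intro mult_left_mono) auto
  then show ?thesis
    using a assms by (simp add: ln_div algebra_simps)
qed (use assms in auto)

text \<open>Adding the tangent inequalities at \<open>b\<close> and at \<open>1 - b\<close> cancels
  the corrections \<open>a - b\<close> and \<open>b - a\<close>. Equivalently, the relative entropy
  of two Bernoulli laws is nonnegative.\<close>

lemma bin_entropy_ge:
  assumes "0 \<le> a" "a \<le> 1" "0 < b" "b < 1"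
  shows "a * ln b + (1 - a) * ln (1 - b) \<le> bin_entropy a"
  using xlnx_ge[of a b] xlnx_ge[of "1 - a" "1 - b"] assms by (simp add: bin_entropy_def)

text \<open>At \<open>1/2\<close> the tangent line is horizontal, with constant value
  \<open>- ln 2\<close>.\<close>

lemma bin_entropy_ge_minus_ln2:
  assumes "0 \<le> a" "a \<le> 1"
  shows "- ln 2 \<le> bin_entropy a"
  using bin_entropy_ge[of a "1/2"] assms by (simp add: ln_div algebra_simps)

lemma bin_entropy_tendsto_0: "(bin_entropy \<longlongrightarrow> 0) (at_right 0)"
  unfolding bin_entropy_def[abs_def] by real_asymp

section \<open>Transfer between Borel and Lebesgue measure on [0,1]\<close>

lemma AE_lebesgue01_iff: "(AE x in lebesgue_on {0..1::real}. P x) \<longleftrightarrow> (AE x in lborel01. P x)"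
  by (simp add: AE_restrict_space_iff AE_completion_iff)

text \<open>Extension by zero moves the question to the whole line, where Borel measurable functions
  remain measurable for the completion.\<close>

lemma measurable_lebesgue01:
  fixes f :: "real \<Rightarrow> 'a::real_normed_vector"
  assumes "f \<in> borel_measurable borel01"
  shows "f \<in> borel_measurable (lebesgue_on {0..1})"
proof -
  have "(\<lambda>x. indicator {0..1} x *\<^sub>R f x) \<in> borel_measurable borel"
    using assms by (subst (asm) borel_measurable_restrict_space_iff) auto
  then have "(\<lambda>x. indicator {0..1} x *\<^sub>R f x) \<in> borel_measurable lebesgue"
    by (simp add: measurable_completion)
  then show ?thesis
    by (subst borel_measurable_restrict_space_iff) auto
qed

lemma nn_integral_lebesgue01:
  "(\<integral>\<^sup>+x. f x \<partial>lebesgue_on {0..1::real}) = (\<integral>\<^sup>+x. f x \<partial>lborel01)"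
  by (simp add: nn_integral_restrict_space nn_integral_completion)

lemma finite_measure_lebesgue01: "finite_measure (lebesgue_on {0..1::real})"
  by (auto intro!: finite_measureI simp: emeasure_restrict_space)

lemma finite_measure_lborel01: "finite_measure lborel01"
  by (auto intro!: finite_measureI simp: emeasure_restrict_space)

lemma measure_lebesgue01: "measure (lebesgue_on {0..1::real}) {0..1} = 1"
  by (simp add: measure_restrict_space)

lemma ext_integral_cong_AE:
  assumes "AE x in N. f x = g x"
  shows "ext_integral N f = ext_integral N g"
proof -
  have "(\<integral>\<^sup>+x. e2ennreal (f x) \<partial>N) = (\<integral>\<^sup>+x. e2ennreal (g x) \<partial>N)"
    "(\<integral>\<^sup>+x. e2ennreal (- f x) \<partial>N) = (\<integral>\<^sup>+x. e2ennreal (- g x) \<partial>N)"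
    using assms by (auto intro!: nn_integral_cong_AE)
  then show ?thesis by (simp add: ext_integral_def)
qed

lemma sets_borel01: "a \<in> {0..1} \<Longrightarrow> {0..a} \<in> sets borel01" "{x} \<in> sets borel01 \<longleftrightarrow> x \<in> {0..1}"
  by (auto simp: sets_restrict_space_iff)

lemma space_borel01: "sets \<mu> = sets borel01 \<Longrightarrow> space \<mu> = {0..1}"
  using sets_eq_imp_space_eq[of \<mu> borel01] by (simp add: space_restrict_space)

section \<open>Distribution functions under weak convergence\<close>

text \<open>Countability of the atoms turns convergence at non-atoms into convergence almost
  everywhere.\<close>

lemma AE_no_atom:
  assumes "finite_measure \<mu>"
  shows "AE x in lebesgue_on {0..1::real}. measure \<mu> {x} = 0"
proof -
  have "{x. measure \<mu> {x} \<noteq> 0} \<in> null_sets lborel"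
    using finite_measure.countable_support[OF assms] by (rule countable_imp_null_set_lborel)
  then have "AE x in lborel. measure \<mu> {x} = 0"
    by (auto dest: AE_not_in)
  then show ?thesis
    by (auto simp: AE_lebesgue01_iff AE_restrict_space_iff)
qed

text \<open>The indicator of \<open>{0..x}\<close> is squeezed between two continuous ramps, whose
  integrals against the limit measure both tend to the mass of \<open>{0..x}\<close> because
  \<open>x\<close> carries no mass.\<close>

lemma weak_conv_imp_cdf_conv:
  fixes \<mu>s :: "nat \<Rightarrow> real measure"
  assumes fin: "finite_measure \<mu>" "\<And>n. finite_measure (\<mu>s n)"
    and sets: "sets \<mu> = sets borel01" "\<And>n. sets (\<mu>s n) = sets borel01"
    and conv: "\<And>g::real \<Rightarrow> real. continuous_on {0..1} g \<Longrightarrow>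
      (\<lambda>n. \<integral>x. g x \<partial>\<mu>s n) \<longlonglongrightarrow> (\<integral>x. g x \<partial>\<mu>)"
    and x: "x \<in> {0..1}" "measure \<mu> {x} = 0"
  shows "(\<lambda>n. measure (\<mu>s n) {0..x}) \<longlonglongrightarrow> measure \<mu> {0..x}"
proof -
  \<comment> \<open>For \<open>k > 0\<close>, \<open>ramp 0 k\<close> falls from 1 to 0 on
    \<open>[x - 1/k, x]\<close> and \<open>ramp 1 k\<close> does so on \<open>[x, x + 1/k]\<close>;
    hence the first lies below the indicator and the second above it.\<close>
  define ramp :: "real \<Rightarrow> nat \<Rightarrow> real \<Rightarrow> real" where
    "ramp c k y = max 0 (min 1 (c + real k * (x - y)))" for c k y
  have cont: "continuous_on A (ramp c k)" for A c k
    unfolding ramp_def by (intro continuous_intros)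
  have int: "integrable \<nu> (ramp c k)" "integrable \<nu> (indicator {0..x} :: real \<Rightarrow> real)"
    and ind: "(\<integral>y. indicator {0..x} y \<partial>\<nu>) = measure \<nu> {0..x}"
    if "finite_measure \<nu>" "sets \<nu> = sets borel01" for \<nu> c k
  proof -
    interpret finite_measure \<nu> by fact
    have "ramp c k \<in> borel_measurable borel01"
      by (intro measurable_restrict_space1 borel_measurable_continuous_onI cont)
    then show "integrable \<nu> (ramp c k)"
      by (intro integrable_const_bound[where B = 1])
        (auto simp: ramp_def measurable_cong_sets[OF that(2) refl])
    have "{0..x} \<in> sets \<nu>" using that(2) sets_borel01(1)[OF x(1)] by simp
    then show "integrable \<nu> (indicator {0..x} :: real \<Rightarrow> real)"
      "(\<integral>y. indicator {0..x} y \<partial>\<nu>) = measure \<nu> {0..x}"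
      by (auto simp: emeasure_eq_measure Int_absorb1 sets.sets_into_space)
  qed
  have lower: "(\<integral>y. ramp 0 k y \<partial>\<nu>) \<le> measure \<nu> {0..x}"
    and upper: "measure \<nu> {0..x} \<le> (\<integral>y. ramp 1 k y \<partial>\<nu>)"
    if \<nu>: "finite_measure \<nu>" "sets \<nu> = sets borel01" for \<nu> k
  proof -
    have le: "ramp 0 k y \<le> indicator {0..x} y" "indicator {0..x} y \<le> ramp 1 k y" if "y \<in> space \<nu>" for y
      using that by (auto simp: space_borel01[OF \<nu>(2)] ramp_def indicator_def min_le_iff_disj mult_nonneg_nonpos)
    show "(\<integral>y. ramp 0 k y \<partial>\<nu>) \<le> measure \<nu> {0..x}" "measure \<nu> {0..x} \<le> (\<integral>y. ramp 1 k y \<partial>\<nu>)"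
      using integral_mono[OF int(1)[OF \<nu>] int(2)[OF \<nu>] le(1)] integral_mono[OF int(2)[OF \<nu>] int(1)[OF \<nu>] le(2)]
      by (simp_all only: ind[OF \<nu>])
  qed
  interpret finite_measure \<mu> by fact
  have "{x} \<in> null_sets \<mu>"
    using x sets by (auto simp: null_sets_def emeasure_eq_measure sets_borel01)
  then have ne: "AE y in \<mu>. y \<noteq> x"
    by (auto dest: AE_not_in)
  have ptw: "AE y in \<mu>. (\<lambda>k. ramp c k y) \<longlonglongrightarrow> indicator {0..x} y" if c: "c \<in> {0, 1}" for c
    using ne AE_space
  proof eventually_elim
    fix y assume y: "y \<noteq> x" "y \<in> space \<mu>"
    have "filterlim (\<lambda>k. real k * \<bar>x - y\<bar>) at_top sequentially"
      using y by (intro filterlim_at_top_mult_tendsto_pos[OF tendsto_const] filterlim_real_sequentially) auto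
    \<comment> \<open>From then on \<open>y\<close> is outside the sloping part, so the ramp equals
      the indicator exactly.\<close>
    then have "eventually (\<lambda>k. 1 \<le> real k * \<bar>x - y\<bar>) sequentially"
      by (auto simp: filterlim_at_top)
    then have "eventually (\<lambda>k. ramp c k y = indicator {0..x} y) sequentially"
    proof eventually_elim
      case (elim k)
      show ?case
        using elim y c by (cases "y < x") (auto simp: ramp_def space_borel01[OF sets(1)] indicator_def algebra_simps)
    qed
    then show "(\<lambda>k. ramp c k y) \<longlonglongrightarrow> indicator {0..x} y"
      by (rule tendsto_eventually)
  qed
  have lim: "(\<lambda>k. \<integral>y. ramp c k y \<partial>\<mu>) \<longlonglongrightarrow> measure \<mu> {0..x}" if "c \<in> {0, 1}" for c
    unfolding ind[OF fin(1) sets(1), symmetric]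
  proof (rule integral_dominated_convergence[where w = "\<lambda>_. 1"])
    show "AE y in \<mu>. norm (ramp c k y) \<le> 1" for k
      by (simp add: ramp_def)
  qed (use ptw[OF that] int[OF fin(1) sets(1)] in \<open>auto intro: borel_measurable_integrable\<close>)
  show ?thesis
  proof (rule order_tendstoI)
    \<comment> \<open>The index \<open>k\<close> is fixed using the limit measure alone; only then
      does \<open>n\<close> grow, with one fixed continuous test function. The upper estimate
      proceeds in the same order.\<close>
    fix a assume "a < measure \<mu> {0..x}"
    then have "eventually (\<lambda>k. a < (\<integral>y. ramp 0 k y \<partial>\<mu>)) sequentially"
      by (intro order_tendstoD(1)[OF lim]) auto
    then obtain k where "a < (\<integral>y. ramp 0 k y \<partial>\<mu>)"
      using eventually_happens'[OF sequentially_bot] by blast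
    then have "eventually (\<lambda>n. a < (\<integral>y. ramp 0 k y \<partial>\<mu>s n)) sequentially"
      by (intro order_tendstoD(1)[OF conv[OF cont]])
    then show "eventually (\<lambda>n. a < measure (\<mu>s n) {0..x}) sequentially"
      by eventually_elim (use lower[OF fin(2) sets(2)] in \<open>auto intro: less_le_trans\<close>)
  next
    fix a assume "measure \<mu> {0..x} < a"
    then have "eventually (\<lambda>k. (\<integral>y. ramp 1 k y \<partial>\<mu>) < a) sequentially"
      by (intro order_tendstoD(2)[OF lim]) auto
    then obtain k where "(\<integral>y. ramp 1 k y \<partial>\<mu>) < a"
      using eventually_happens'[OF sequentially_bot] by blast
    then have "eventually (\<lambda>n. (\<integral>y. ramp 1 k y \<partial>\<mu>s n) < a) sequentially"
      by (intro order_tendstoD(2)[OF conv[OF cont]])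
    then show "eventually (\<lambda>n. measure (\<mu>s n) {0..x} < a) sequentially"
      by eventually_elim (use upper[OF fin(2) sets(2)] in \<open>auto intro: le_less_trans\<close>)
  qed
qed

section \<open>Smearing a measure into one with bounded density\<close>

definition window :: "nat \<Rightarrow> real \<Rightarrow> real set" where
  "window n y = {y * (1 - 1 / Suc n)..y * (1 - 1 / Suc n) + 1 / Suc n}"

text \<open>Each point mass at \<open>y\<close> is spread uniformly over \<open>window n y\<close>, an interval of length
  \<open>1 / Suc n\<close> that never leaves \<open>[0,1]\<close>, so that the total mass does not change.\<close>

definition smear :: "nat \<Rightarrow> real measure \<Rightarrow> real measure" where
  "smear n \<mu> = density lborel01 (\<lambda>x. \<integral>\<^sup>+y. ennreal (Suc n) * indicator (window n y) x \<partial>\<mu>)"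

lemma sets_smear: "sets (smear n \<mu>) = sets borel01"
  by (simp add: smear_def sets_restrict_space)

text \<open>The left endpoint maps [0,1] linearly onto \<open>[0, 1 - 1 / Suc n]\<close>, which
  leaves exactly the length of the window free on the right.\<close>

lemma window_subset:
  assumes "y \<in> {0..1}"
  shows "window n y \<subseteq> {0..1}"
proof -
  have c: "0 \<le> 1 - 1 / real (Suc n)" by simp
  have "y * (1 - 1 / Suc n) \<le> 1 * (1 - 1 / Suc n)" "0 \<le> y * (1 - 1 / Suc n)"
    using assms mult_right_mono[OF _ c, of y 1] mult_nonneg_nonneg[OF _ c, of y] by auto
  then show ?thesis unfolding window_def by auto
qed

lemma emeasure_window: "ennreal (Suc n) * emeasure lborel (window n y) = 1"
proof -
  have "emeasure lborel (window n y) = ennreal (1 / Suc n)"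
    by (simp add: window_def del: of_nat_Suc)
  then show ?thesis
    by (simp del: of_nat_Suc flip: ennreal_mult)
qed

text \<open>Joint measurability licenses the exchange of integrals in \<open>emeasure_smear\<close>;
  it holds because membership in the window amounts to two inequalities continuous in both
  variables.\<close>

lemma measurable_window [measurable]:
  assumes "sets \<mu> = sets borel01"
  shows "(\<lambda>(x, y). ennreal (Suc n) * indicator (window n y) x) \<in> borel_measurable (lborel01 \<Otimes>\<^sub>M \<mu>)"
proof -
  have [measurable]: "fst \<in> borel_measurable (borel01 \<Otimes>\<^sub>M borel01)" "snd \<in> borel_measurable (borel01 \<Otimes>\<^sub>M borel01)"
    using measurable_compose[OF measurable_fst measurable_restrict_space1[OF measurable_ident]]
      measurable_compose[OF measurable_snd measurable_restrict_space1[OF measurable_ident]]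
    by (auto simp: id_def)
  have eq: "sets (lborel01 \<Otimes>\<^sub>M \<mu>) = sets (borel01 \<Otimes>\<^sub>M borel01)"
    using assms by (intro sets_pair_measure_cong) (auto simp: sets_restrict_space)
  have "(\<lambda>p. ennreal (Suc n) * (if snd p * (1 - 1 / Suc n) \<le> fst p \<and> fst p \<le> snd p * (1 - 1 / Suc n) + 1 / Suc n
      then 1 else 0)) \<in> borel_measurable (borel01 \<Otimes>\<^sub>M borel01)"
    by measurable
  then show ?thesis
    unfolding measurable_cong_sets[OF eq refl]
    by (simp only: case_prod_beta' indicator_def of_bool_def window_def atLeastAtMost_iff)
qed

lemma density_smear_measurable:
  assumes "finite_measure \<mu>" "sets \<mu> = sets borel01"
  shows "(\<lambda>x. \<integral>\<^sup>+y. ennreal (Suc n) * indicator (window n y) x \<partial>\<mu>) \<in> borel_measurable lborel01"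
proof -
  interpret finite_measure \<mu> by fact
  show ?thesis
    using measurable_window[OF assms(2)] by (rule borel_measurable_nn_integral)
qed

text \<open>By Tonelli, \<open>smear n \<mu>\<close> is the mixture over \<open>y\<close> of the
  uniform distributions on \<open>window n y\<close>.\<close>

lemma emeasure_smear:
  assumes fin: "finite_measure \<mu>" and sets: "sets \<mu> = sets borel01" and A: "A \<in> sets borel01"
  shows "emeasure (smear n \<mu>) A = (\<integral>\<^sup>+y. ennreal (Suc n) * emeasure lborel (A \<inter> window n y) \<partial>\<mu>)"
proof -
  interpret finite_measure \<mu> by fact
  interpret L: finite_measure lborel01 by (rule finite_measure_lborel01)
  interpret pair_sigma_finite lborel01 \<mu> ..
  have AL [measurable]: "A \<in> sets lborel01" using A by (simp add: sets_restrict_space)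
  note [measurable] = measurable_window[OF sets] density_smear_measurable[OF fin sets]
  have A01: "A \<subseteq> {0..1}" using sets.sets_into_space[OF A] by (simp add: space_restrict_space)
  have Ab: "A \<in> sets borel" using A by (simp add: sets_restrict_space_iff)
  have "emeasure (smear n \<mu>) A =
      (\<integral>\<^sup>+x. (\<integral>\<^sup>+y. ennreal (Suc n) * indicator (window n y) x \<partial>\<mu>) * indicator A x \<partial>lborel01)"
    unfolding smear_def by (rule emeasure_density) measurable
  also have "\<dots> = (\<integral>\<^sup>+x. (\<integral>\<^sup>+y. ennreal (Suc n) * indicator (window n y) x * indicator A x \<partial>\<mu>) \<partial>lborel01)"
  proof (rule nn_integral_cong)
    fix x assume "x \<in> space lborel01"
    then have "(\<lambda>y. ennreal (Suc n) * indicator (window n y) x) \<in> borel_measurable \<mu>"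
      using measurable_compose[OF measurable_Pair1' measurable_window[OF sets]] by simp
    then show "(\<integral>\<^sup>+y. ennreal (Suc n) * indicator (window n y) x \<partial>\<mu>) * indicator A x =
      (\<integral>\<^sup>+y. ennreal (Suc n) * indicator (window n y) x * indicator A x \<partial>\<mu>)"
      by (rule nn_integral_multc[symmetric])
  qed
  also have "\<dots> = (\<integral>\<^sup>+y. (\<integral>\<^sup>+x. ennreal (Suc n) * indicator (window n y) x * indicator A x \<partial>lborel01) \<partial>\<mu>)"
    by (rule Fubini'[symmetric]) (use measurable_window[OF sets] in measurable)
  also have "\<dots> = (\<integral>\<^sup>+y. ennreal (Suc n) * emeasure lborel (A \<inter> window n y) \<partial>\<mu>)"
  proof (rule nn_integral_cong)
    fix y
    have "A \<inter> window n y \<in> sets borel" using Ab by (auto simp: window_def)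
    then have W: "A \<inter> window n y \<in> sets lborel01" using A01 by (auto simp: sets_restrict_space_iff)
    have "(\<integral>\<^sup>+x. ennreal (Suc n) * indicator (window n y) x * indicator A x \<partial>lborel01) =
        (\<integral>\<^sup>+x. ennreal (Suc n) * indicator (A \<inter> window n y) x \<partial>lborel01)"
      by (intro nn_integral_cong) (auto simp: indicator_def)
    also have "\<dots> = ennreal (Suc n) * emeasure lborel01 (A \<inter> window n y)"
      using W by (rule nn_integral_cmult_indicator)
    also have "emeasure lborel01 (A \<inter> window n y) = emeasure lborel (A \<inter> window n y)"
      using A01 by (intro emeasure_restrict_space) auto
    finally show "(\<integral>\<^sup>+x. ennreal (Suc n) * indicator (window n y) x * indicator A x \<partial>lborel01) =
      ennreal (Suc n) * emeasure lborel (A \<inter> window n y)" .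
  qed
  finally show ?thesis .
qed

lemma emeasure_smear_total:
  assumes "finite_measure \<mu>" "sets \<mu> = sets borel01"
  shows "emeasure (smear n \<mu>) {0..1} = emeasure \<mu> {0..1}"
proof -
  have "emeasure (smear n \<mu>) {0..1} = (\<integral>\<^sup>+y. ennreal (Suc n) * emeasure lborel ({0..1} \<inter> window n y) \<partial>\<mu>)"
    using assms sets_borel01(1)[of 1] by (intro emeasure_smear) auto
  also have "\<dots> = (\<integral>\<^sup>+y. 1 \<partial>\<mu>)"
  proof (rule nn_integral_cong)
    fix y assume "y \<in> space \<mu>"
    then have "{0..1} \<inter> window n y = window n y"
      using window_subset[of y n] by (auto simp: space_borel01[OF assms(2)])
    then show "ennreal (Suc n) * emeasure lborel ({0..1} \<inter> window n y) = 1"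
      by (simp only: emeasure_window)
  qed
  finally show ?thesis
    by (simp add: space_borel01[OF assms(2)])
qed

lemma finite_measure_smear:
  assumes "finite_measure \<mu>" "sets \<mu> = sets borel01"
  shows "finite_measure (smear n \<mu>)"
  using emeasure_smear_total[OF assms, of n] finite_measure.emeasure_finite[OF assms(1)]
  by (intro finite_measureI) (auto simp: space_borel01[OF sets_smear])

text \<open>Since the windows shrink to \<open>y\<close>, the fraction of \<open>window n y\<close>
  inside \<open>{0..x}\<close> is eventually 1 for \<open>y < x\<close> and 0 for
  \<open>y > x\<close>, and dominated convergence applies. At \<open>y = x\<close> that fraction is
  \<open>x\<close> for every \<open>n\<close>, so an atom there would be split.\<close>

lemma smear_cdf_conv:
  assumes fin: "finite_measure \<mu>" and sets: "sets \<mu> = sets borel01"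
    and x: "x \<in> {0..1}" "measure \<mu> {x} = 0"
  shows "(\<lambda>n. measure (smear n \<mu>) {0..x}) \<longlonglongrightarrow> measure \<mu> {0..x}"
proof -
  interpret finite_measure \<mu> by fact
  define p where "p n y = ennreal (Suc n) * emeasure lborel ({0..x} \<inter> window n y)" for n y
  have le1: "p n y \<le> 1" for n y
  proof -
    have "p n y \<le> ennreal (Suc n) * emeasure lborel (window n y)"
      unfolding p_def by (intro mult_left_mono emeasure_mono) (auto simp: window_def)
    then show ?thesis by (simp only: emeasure_window)
  qed
  have meas: "p n \<in> borel_measurable \<mu>" for n
  proof -
    \<comment> \<open>The length of the intersection of the two intervals in closed form makes
      measurability in \<open>y\<close> evident.\<close>
    have eq: "p n y = ennreal (Suc n) * ennreal (max 0
        (min x (y * (1 - 1 / Suc n) + 1 / Suc n) - max 0 (y * (1 - 1 / Suc n))))" for y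
      by (auto simp: p_def window_def Int_atLeastAtMost max_def)
    have "(\<lambda>y. ennreal (Suc n) * ennreal (max 0
        (min x (y * (1 - 1 / Suc n) + 1 / Suc n) - max 0 (y * (1 - 1 / Suc n))))) \<in> borel_measurable borel01"
      by (intro measurable_restrict_space1) measurable
    then show ?thesis
      unfolding eq[abs_def] by (simp add: measurable_cong_sets[OF sets refl])
  qed
  have ms: "{0..x} \<in> sets \<mu>" using sets sets_borel01(1)[OF x(1)] by simp
  have "{x} \<in> null_sets \<mu>"
    using x sets by (auto simp: null_sets_def emeasure_eq_measure sets_borel01)
  then have "AE y in \<mu>. y \<noteq> x"
    by (auto dest: AE_not_in)
  then have ptw: "AE y in \<mu>. (\<lambda>n. p n y) \<longlonglongrightarrow> indicator {0..x} y"
    using AE_space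
  proof eventually_elim
    fix y assume y: "y \<noteq> x" "y \<in> space \<mu>"
    then have y01: "y \<in> {0..1}" by (simp add: space_borel01[OF sets])
    have inv0: "(\<lambda>n. 1 / real (Suc n)) \<longlonglongrightarrow> 0"
      using LIMSEQ_inverse_real_of_nat by (simp add: inverse_eq_divide)
    have L: "(\<lambda>n. y * (1 - 1 / Suc n)) \<longlonglongrightarrow> y"
      using tendsto_mult[OF tendsto_const tendsto_diff[OF tendsto_const inv0], of y 1] by simp
    have U: "(\<lambda>n. y * (1 - 1 / Suc n) + 1 / Suc n) \<longlonglongrightarrow> y"
      using tendsto_add[OF L inv0] by simp
    show "(\<lambda>n. p n y) \<longlonglongrightarrow> indicator {0..x} y"
    proof (cases "y < x")
      case True
      have "eventually (\<lambda>n. p n y = 1) sequentially"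
        using order_tendstoD(2)[OF U True]
      proof eventually_elim
        case (elim n)
        then have "{0..x} \<inter> window n y = window n y"
          using window_subset[OF y01, of n] by (auto simp: window_def)
        then show ?case by (simp only: p_def emeasure_window)
      qed
      then show ?thesis using True y01 by (auto intro!: tendsto_eventually)
    next
      case False
      then have "x < y" using y by simp
      have "eventually (\<lambda>n. p n y = 0) sequentially"
        using order_tendstoD(1)[OF L \<open>x < y\<close>]
      proof eventually_elim
        case (elim n)
        then have "{0..x} \<inter> window n y = {}" by (auto simp: window_def)
        then show ?case by (simp add: p_def)
      qed
      then show ?thesis using \<open>x < y\<close> by (auto intro!: tendsto_eventually)
    qed
  qed
  have "(\<lambda>n. \<integral>\<^sup>+y. p n y \<partial>\<mu>) \<longlonglongrightarrow> (\<integral>\<^sup>+y. indicator {0..x} y \<partial>\<mu>)"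
    by (rule nn_integral_dominated_convergence[where w = "\<lambda>_. 1"])
      (use meas ptw le1 ms in \<open>auto simp: less_top[symmetric]\<close>)
  then have "(\<lambda>n. emeasure (smear n \<mu>) {0..x}) \<longlonglongrightarrow> ennreal (measure \<mu> {0..x})"
    using ms by (simp add: p_def emeasure_smear[OF fin sets sets_borel01(1)[OF x(1)]] emeasure_eq_measure)
  then have "(\<lambda>n. enn2real (emeasure (smear n \<mu>) {0..x})) \<longlonglongrightarrow> measure \<mu> {0..x}"
    by (rule tendsto_enn2real) simp
  then show ?thesis
    by (simp add: measure_def)
qed

section \<open>Monotonicity, bounds and measurability in \<open>F_set\<close>\<close>

lemma F_set_has_measure:
  assumes "\<phi> \<in> F_set \<phi>0 \<phi>1"
  shows "has_measure \<phi>0 \<phi> (dmeas \<phi>0 \<phi>)" "measure (dmeas \<phi>0 \<phi>) {0..1} = \<phi>1 - \<phi>0"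
  using assms by (auto simp: F_set_def dmeas_eq)

lemma has_measureD:
  assumes "has_measure \<phi>0 \<phi> \<mu>"
  shows "finite_measure \<mu>" "sets \<mu> = sets borel01" "x \<in> {0..1} \<Longrightarrow> \<phi> x = \<phi>0 + measure \<mu> {0..x}"
  using assms by (auto simp: has_measure_def)

lemma F_set_mono_on:
  assumes "\<phi> \<in> F_set \<phi>0 \<phi>1"
  shows "mono_on {0..1} \<phi>"
proof (rule mono_onI)
  note hm = has_measureD[OF F_set_has_measure(1)[OF assms]]
  interpret finite_measure "dmeas \<phi>0 \<phi>" by (rule hm)
  fix x y :: real assume xy: "x \<in> {0..1}" "y \<in> {0..1}" "x \<le> y"
  then show "\<phi> x \<le> \<phi> y"
    using hm(2) sets_borel01(1) by (auto simp: hm(3) intro!: finite_measure_mono)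
qed

lemma F_set_bounds:
  assumes "\<phi> \<in> F_set \<phi>0 \<phi>1" "x \<in> {0..1}"
  shows "\<phi>0 \<le> \<phi> x" "\<phi> x \<le> \<phi>1"
  using has_measureD(3)[OF F_set_has_measure(1)[OF assms(1)]] F_set_has_measure(2)[OF assms(1)]
    mono_onD[OF F_set_mono_on[OF assms(1)], of x 1] assms(2) by auto

lemma F_set_measurable: "\<phi> \<in> F_set \<phi>0 \<phi>1 \<Longrightarrow> \<phi> \<in> borel_measurable (lebesgue_on {0..1})"
  by (intro measurable_lebesgue01 borel_measurable_mono_on_fnc F_set_mono_on)

section \<open>The limit functional as a finite integral, and its continuity\<close>

definition energy_density :: "(real \<Rightarrow> real) \<Rightarrow> (real \<Rightarrow> real) \<Rightarrow> real \<Rightarrow> real" where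
  "energy_density \<rho> \<phi> x = bin_entropy (\<rho> x) + ((1 - \<rho> x) * \<phi> x - ln (1 + exp (\<phi> x)))"

definition energy :: "(real \<Rightarrow> real) \<Rightarrow> (real \<Rightarrow> real) \<Rightarrow> real" where
  "energy \<rho> \<phi> = (\<integral>x. energy_density \<rho> \<phi> x \<partial>lebesgue_on {0..1})"

lemma M_setD:
  assumes "\<rho> \<in> M_set"
  shows "\<rho> \<in> borel_measurable (lebesgue_on {0..1})"
    "AE x in lebesgue_on {0..1}. 0 \<le> \<rho> x \<and> \<rho> x \<le> 1"
  using assms by (auto simp: M_set_def)

lemma energy_density_measurable:
  assumes "\<rho> \<in> M_set" "\<phi> \<in> F_set \<phi>0 \<phi>1"
  shows "energy_density \<rho> \<phi> \<in> borel_measurable (lebesgue_on {0..1})"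
proof -
  note [measurable] = M_setD(1)[OF assms(1)] F_set_measurable[OF assms(2)]
  show ?thesis unfolding energy_density_def[abs_def] by measurable
qed

text \<open>The bound depends only on the endpoint values, so one constant dominates the integrands
  of a whole sequence in \<open>F_set\<close>.\<close>

lemma energy_density_bound:
  assumes "\<rho> \<in> M_set" "\<phi> \<in> F_set \<phi>0 \<phi>1"
  shows "AE x in lebesgue_on {0..1}.
    norm (energy_density \<rho> \<phi> x) \<le> ln 2 + (\<bar>\<phi>0\<bar> + \<bar>\<phi>1\<bar>) + ln (1 + exp \<phi>1)"
  using M_setD(2)[OF assms(1)] AE_space
proof eventually_elim
  case (elim x)
  then have x: "x \<in> {0..1}" by simp
  have "\<bar>bin_entropy (\<rho> x)\<bar> \<le> ln 2"
    using bin_entropy_nonpos[of "\<rho> x"] bin_entropy_ge_minus_ln2[of "\<rho> x"] elim by auto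
  moreover have "\<bar>(1 - \<rho> x) * \<phi> x\<bar> \<le> \<bar>\<phi>0\<bar> + \<bar>\<phi>1\<bar>"
  proof -
    have "\<bar>(1 - \<rho> x) * \<phi> x\<bar> \<le> 1 * \<bar>\<phi> x\<bar>"
      unfolding abs_mult using elim by (intro mult_right_mono) auto
    then show ?thesis using F_set_bounds[OF assms(2) x] by linarith
  qed
  \<comment> \<open>The function \<open>ln (1 + exp t)\<close> is positive and increasing, so the
    bound at the largest value \<open>\<phi>1\<close> suffices.\<close>
  moreover have "\<bar>ln (1 + exp (\<phi> x))\<bar> \<le> ln (1 + exp \<phi>1)"
    using F_set_bounds[OF assms(2) x] by (simp add: add_pos_pos)
  ultimately show ?case unfolding energy_density_def real_norm_def by linarith
qed

lemma integrable_energy_density: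
  assumes "\<rho> \<in> M_set" "\<phi> \<in> F_set \<phi>0 \<phi>1"
  shows "integrable (lebesgue_on {0..1}) (energy_density \<rho> \<phi>)"
  using energy_density_bound[OF assms] energy_density_measurable[OF assms]
  by (rule finite_measure.integrable_const_bound[OF finite_measure_lebesgue01])

text \<open>The extended and the real integrand agree wherever \<open>\<rho>\<close> lies in [0,1],
  and the latter is integrable.\<close>

lemma G_lim_eq_energy:
  assumes "\<rho> \<in> M_set" "\<phi> \<in> F_set \<phi>0 \<phi>1"
  shows "G_lim \<rho> \<phi> = ereal (energy \<rho> \<phi>)"
proof -
  have "G_lim \<rho> \<phi> = ext_integral (lebesgue_on {0..1}) (\<lambda>x. ereal (energy_density \<rho> \<phi> x))"
    unfolding G_lim_def
    by (rule ext_integral_cong_AE)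
      (use M_setD(2)[OF assms(1)] in \<open>eventually_elim, simp add: energy_density_def s_ent_eq\<close>)
  then show ?thesis
    by (simp add: ext_integral_eq_integral[OF integrable_energy_density[OF assms]] energy_def)
qed

lemma energy_tendsto:
  assumes "\<rho> \<in> M_set" "\<phi> \<in> F_set \<phi>0 \<phi>1" "\<And>n. \<phi>s n \<in> F_set \<phi>0 \<phi>1"
    and "AE x in lebesgue_on {0..1}. (\<lambda>n. \<phi>s n x) \<longlonglongrightarrow> \<phi> x"
  shows "(\<lambda>n. energy \<rho> (\<phi>s n)) \<longlonglongrightarrow> energy \<rho> \<phi>"
  unfolding energy_def
proof (rule integral_dominated_convergence)
  show "integrable (lebesgue_on {0..1}) (\<lambda>x::real. ln 2 + (\<bar>\<phi>0\<bar> + \<bar>\<phi>1\<bar>) + ln (1 + exp \<phi>1))"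
    by (rule finite_measure.integrable_const[OF finite_measure_lebesgue01])
  have nz: "1 + exp t \<noteq> 0" for t :: real
    using exp_gt_zero[of t] by linarith
  show "AE x in lebesgue_on {0..1}. (\<lambda>n. energy_density \<rho> (\<phi>s n) x) \<longlonglongrightarrow> energy_density \<rho> \<phi> x"
    using assms(4) by eventually_elim (auto simp: energy_density_def nz intro!: tendsto_intros)
qed (use assms energy_density_measurable energy_density_bound in blast)+

section \<open>The density of an admissible function and its entropy term\<close>

lemma density_x_nonneg: "0 \<le> density_x \<phi>0 \<phi> x"
  by (simp add: density_x_def)

lemma density_x_measurable: "density_x \<phi>0 \<phi> \<in> borel_measurable (lebesgue_on {0..1})"
proof (rule measurable_lebesgue01)
  have "density_x \<phi>0 \<phi> \<in> borel_measurable lborel01"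
    unfolding density_x_def[abs_def] by measurable
  moreover have "sets lborel01 = sets borel01"
    by (simp add: sets_restrict_space)
  ultimately show "density_x \<phi>0 \<phi> \<in> borel_measurable borel01"
    using measurable_cong_sets by blast
qed

lemma sigma_finite_lborel01: "sigma_finite_measure lborel01"
  using finite_measure_lborel01 by (simp add: finite_measure_def)

lemma integral_density_x:
  assumes "\<phi> \<in> F_set \<phi>0 \<phi>1" "absolutely_continuous lborel01 (dmeas \<phi>0 \<phi>)"
  shows "integrable (lebesgue_on {0..1}) (density_x \<phi>0 \<phi>)"
    "(\<integral>x. density_x \<phi>0 \<phi> x \<partial>lebesgue_on {0..1}) = \<phi>1 - \<phi>0"
proof -
  note hm = has_measureD[OF F_set_has_measure(1)[OF assms(1)]]
  interpret D: finite_measure "dmeas \<phi>0 \<phi>" by (rule hm)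
  interpret L: sigma_finite_measure lborel01 by (rule sigma_finite_lborel01)
  have sets: "sets (dmeas \<phi>0 \<phi>) = sets lborel01"
    using hm(2) by (simp add: sets_restrict_space)
  \<comment> \<open>Since \<open>enn2real\<close> sends \<open>\<infinity>\<close> to 0, no mass is
    lost in \<open>density_x\<close> only because the derivative is finite almost
    everywhere.\<close>
  have "AE x in lborel01. RN_deriv lborel01 (dmeas \<phi>0 \<phi>) x \<noteq> \<infinity>"
    using assms(2) sets D.sigma_finite_measure_axioms by (intro L.RN_deriv_finite)
  then have "(\<integral>\<^sup>+x. ennreal (density_x \<phi>0 \<phi> x) \<partial>lborel01) = (\<integral>\<^sup>+x. RN_deriv lborel01 (dmeas \<phi>0 \<phi>) x * 1 \<partial>lborel01)"
    by (intro nn_integral_cong_AE, eventually_elim) (auto simp: density_x_def less_top)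
  also have "\<dots> = (\<integral>\<^sup>+x. 1 \<partial>dmeas \<phi>0 \<phi>)"
    using assms(2) sets by (intro L.RN_deriv_nn_integral[symmetric]) auto
  also have "\<dots> = ennreal (\<phi>1 - \<phi>0)"
    by (simp add: space_borel01[OF hm(2)] D.emeasure_eq_measure F_set_has_measure(2)[OF assms(1)])
  finally have nn: "(\<integral>\<^sup>+x. ennreal (density_x \<phi>0 \<phi> x) \<partial>lebesgue_on {0..1}) = ennreal (\<phi>1 - \<phi>0)"
    by (simp add: nn_integral_lebesgue01)
  have "0 \<le> \<phi>1 - \<phi>0"
    using F_set_has_measure(2)[OF assms(1)] measure_nonneg by metis
  with nn show "integrable (lebesgue_on {0..1}) (density_x \<phi>0 \<phi>)"
    "(\<integral>x. density_x \<phi>0 \<phi> x \<partial>lebesgue_on {0..1}) = \<phi>1 - \<phi>0"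
    by (auto intro!: integrableI_nn_integral_finite density_x_measurable
        simp: density_x_nonneg integral_eq_nn_integral density_x_measurable)
qed

definition mix_entropy :: "real \<Rightarrow> real \<Rightarrow> (real \<Rightarrow> real) \<Rightarrow> real" where
  "mix_entropy \<phi>0 \<epsilon> \<phi> = (\<integral>x. bin_entropy (\<epsilon> * density_x \<phi>0 \<phi> x) \<partial>lebesgue_on {0..1})"

lemma scaled_density_AE:
  assumes "0 < \<epsilon>" "AE x in lborel01. density_x \<phi>0 \<phi> x \<le> 1 / \<epsilon>"
  shows "AE x in lebesgue_on {0..1}. 0 \<le> \<epsilon> * density_x \<phi>0 \<phi> x \<and> \<epsilon> * density_x \<phi>0 \<phi> x \<le> 1"
  using assms(2) unfolding AE_lebesgue01_iff
  by eventually_elim (use assms(1) density_x_nonneg in \<open>auto simp: field_simps\<close>)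

lemma integrable_mix_entropy:
  assumes "0 < \<epsilon>" "AE x in lborel01. density_x \<phi>0 \<phi> x \<le> 1 / \<epsilon>"
  shows "integrable (lebesgue_on {0..1}) (\<lambda>x. bin_entropy (\<epsilon> * density_x \<phi>0 \<phi> x))"
proof (rule finite_measure.integrable_const_bound[OF finite_measure_lebesgue01])
  show "AE x in lebesgue_on {0..1}. norm (bin_entropy (\<epsilon> * density_x \<phi>0 \<phi> x)) \<le> ln 2"
    using scaled_density_AE[OF assms]
    by eventually_elim (use bin_entropy_nonpos bin_entropy_ge_minus_ln2 in \<open>fastforce simp: abs_le_iff\<close>)
  note [measurable] = density_x_measurable
  show "(\<lambda>x. bin_entropy (\<epsilon> * density_x \<phi>0 \<phi> x)) \<in> borel_measurable (lebesgue_on {0..1})"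
    by measurable
qed

lemma mix_entropy_nonpos:
  assumes "0 < \<epsilon>" "AE x in lborel01. density_x \<phi>0 \<phi> x \<le> 1 / \<epsilon>"
  shows "mix_entropy \<phi>0 \<epsilon> \<phi> \<le> 0"
proof -
  have "mix_entropy \<phi>0 \<epsilon> \<phi> \<le> (\<integral>x. 0 \<partial>lebesgue_on {0..1::real})"
    unfolding mix_entropy_def
    by (rule integral_mono_AE[OF integrable_mix_entropy[OF assms]])
      (use scaled_density_AE[OF assms] in \<open>auto elim: eventually_mono intro: bin_entropy_nonpos\<close>)
  then show ?thesis by simp
qed

text \<open>Jensen's inequality, by integrating the tangent line of the convex function
  \<open>bin_entropy\<close> at the mean \<open>\<epsilon> * (\<phi>1 - \<phi>0)\<close>.\<close>

lemma mix_entropy_ge: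
  assumes "0 < \<epsilon>" "AE x in lborel01. density_x \<phi>0 \<phi> x \<le> 1 / \<epsilon>"
    and "\<phi> \<in> F_set \<phi>0 \<phi>1" "absolutely_continuous lborel01 (dmeas \<phi>0 \<phi>)"
    and "0 < \<epsilon> * (\<phi>1 - \<phi>0)" "\<epsilon> * (\<phi>1 - \<phi>0) < 1"
  shows "bin_entropy (\<epsilon> * (\<phi>1 - \<phi>0)) \<le> mix_entropy \<phi>0 \<epsilon> \<phi>"
proof -
  define b where "b = \<epsilon> * (\<phi>1 - \<phi>0)"
  let ?d = "density_x \<phi>0 \<phi>" and ?L = "lebesgue_on {0..1::real}"
  interpret finite_measure ?L by (rule finite_measure_lebesgue01)
  note d = integral_density_x[OF assms(3,4)]
  have int: "integrable ?L (\<lambda>x. ln (1 - b) + ?d x * (\<epsilon> * (ln b - ln (1 - b))))"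
    using d(1) by simp
  have "bin_entropy b = ln (1 - b) + (\<phi>1 - \<phi>0) * (\<epsilon> * (ln b - ln (1 - b)))"
    by (simp add: bin_entropy_def b_def[symmetric] mult.assoc[symmetric] mult.commute[of _ \<epsilon>])
      (simp add: algebra_simps)
  also have "\<dots> = (\<integral>x. ln (1 - b) + ?d x * (\<epsilon> * (ln b - ln (1 - b))) \<partial>?L)"
    using d by (simp add: measure_lebesgue01)
  also have "\<dots> \<le> mix_entropy \<phi>0 \<epsilon> \<phi>"
    unfolding mix_entropy_def
  proof (rule integral_mono_AE[OF int integrable_mix_entropy[OF assms(1,2)]])
    show "AE x in ?L. ln (1 - b) + ?d x * (\<epsilon> * (ln b - ln (1 - b))) \<le> bin_entropy (\<epsilon> * ?d x)"
      using scaled_density_AE[OF assms(1,2)]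
    proof eventually_elim
      case (elim x)
      then show ?case
        using bin_entropy_ge[of "\<epsilon> * ?d x" b] assms(5,6) by (simp add: b_def algebra_simps)
    qed
  qed
  finally show ?thesis by (simp add: b_def)
qed

text \<open>For admissible functions all entropies are finite almost everywhere and both parts are
  integrable, so the extended integral splits.\<close>

lemma G_eps_eq_energy:
  assumes "\<rho> \<in> M_set" "\<phi> \<in> F_set \<phi>0 \<phi>1" "absolutely_continuous lborel01 (dmeas \<phi>0 \<phi>)"
    and "0 < \<epsilon>" "AE x in lborel01. density_x \<phi>0 \<phi> x \<le> 1 / \<epsilon>"
  shows "G_eps \<phi>0 \<epsilon> \<rho> \<phi> = ereal (energy \<rho> \<phi> + mix_entropy \<phi>0 \<epsilon> \<phi>)"
proof -
  let ?f = "\<lambda>x. energy_density \<rho> \<phi> x + bin_entropy (\<epsilon> * density_x \<phi>0 \<phi> x)"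
  have "G_eps \<phi>0 \<epsilon> \<rho> \<phi> = ext_integral (lebesgue_on {0..1}) (\<lambda>x. ereal (?f x))"
    unfolding G_eps_def if_P[OF conjI[OF assms(3,5)]]
    by (rule ext_integral_cong_AE)
      (use M_setD(2)[OF assms(1)] scaled_density_AE[OF assms(4,5)]
        in \<open>eventually_elim, simp add: energy_density_def s_ent_eq\<close>)
  then show ?thesis
    using integrable_energy_density[OF assms(1,2)] integrable_mix_entropy[OF assms(4,5)]
    by (simp add: ext_integral_eq_integral energy_def mix_entropy_def)
qed

section \<open>Approximation by bounded densities, and almost everywhere limits\<close>

text \<open>The approximants are the distribution functions of \<open>smear n \<mu>\<close>. The
  smearing kernel is at most \<open>Suc n\<close>, so the density is at most \<open>Suc n\<close>
  times the total mass.\<close>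

lemma F_set_bounded_density_approx:
  assumes "\<psi> \<in> F_set \<phi>0 \<phi>1"
  obtains \<psi>s where "\<And>n. \<psi>s n \<in> F_set \<phi>0 \<phi>1"
    "\<And>n. absolutely_continuous lborel01 (dmeas \<phi>0 (\<psi>s n))"
    "\<And>n. \<exists>K. AE x in lborel01. density_x \<phi>0 (\<psi>s n) x \<le> K"
    "AE x in lebesgue_on {0..1}. (\<lambda>n. \<psi>s n x) \<longlonglongrightarrow> \<psi> x"
proof -
  define \<mu> where "\<mu> = dmeas \<phi>0 \<psi>"
  note hm = has_measureD[OF F_set_has_measure(1)[OF assms], folded \<mu>_def]
  interpret finite_measure \<mu> by (rule hm)
  define \<psi>s where "\<psi>s n x = \<phi>0 + measure (smear n \<mu>) {0..x}" for n x
  have has: "has_measure \<phi>0 (\<psi>s n) (smear n \<mu>)" for n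
    using finite_measure_smear[OF hm(1,2)] by (simp add: has_measure_def sets_smear \<psi>s_def)
  note dm = dmeas_eq[OF has]
  note dens = density_smear_measurable[OF hm(1,2)]
  have "\<psi>s n \<in> F_set \<phi>0 \<phi>1" for n
  proof -
    have "measure (smear n \<mu>) {0..1} = \<phi>1 - \<phi>0"
      using emeasure_smear_total[OF hm(1,2)] F_set_has_measure(2)[OF assms]
      by (simp add: measure_def \<mu>_def)
    then show ?thesis using has unfolding F_set_def by blast
  qed
  moreover have "absolutely_continuous lborel01 (dmeas \<phi>0 (\<psi>s n))" for n
    unfolding dm unfolding smear_def by (rule absolutely_continuousI_density[OF dens])
  moreover have "\<exists>K. AE x in lborel01. density_x \<phi>0 (\<psi>s n) x \<le> K" for n
  proof -
    interpret L: sigma_finite_measure lborel01 by (rule sigma_finite_lborel01)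
    \<comment> \<open>The Radon-Nikodym derivative is determined only almost everywhere; uniqueness
      identifies it with the explicit density of \<open>smear\<close>.\<close>
    have "AE x in lborel01. (\<integral>\<^sup>+y. ennreal (Suc n) * indicator (window n y) x \<partial>\<mu>) =
        RN_deriv lborel01 (smear n \<mu>) x"
      by (rule L.RN_deriv_unique[OF dens]) (simp add: smear_def)
    then have "AE x in lborel01. density_x \<phi>0 (\<psi>s n) x \<le> Suc n * measure \<mu> (space \<mu>)"
    proof eventually_elim
      case (elim x)
      have "(\<integral>\<^sup>+y. ennreal (Suc n) * indicator (window n y) x \<partial>\<mu>) \<le> (\<integral>\<^sup>+y. ennreal (Suc n) \<partial>\<mu>)"
        by (intro nn_integral_mono) (auto simp: indicator_def)
      also have "\<dots> = ennreal (Suc n * measure \<mu> (space \<mu>))"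
        by (simp add: emeasure_eq_measure ennreal_mult del: of_nat_Suc)
      finally show ?case
        unfolding density_x_def dm elim[symmetric] by (intro enn2real_leI) auto
    qed
    then show ?thesis ..
  qed
  moreover have "AE x in lebesgue_on {0..1}. (\<lambda>n. \<psi>s n x) \<longlonglongrightarrow> \<psi> x"
    using AE_no_atom[OF hm(1)] AE_space
    by eventually_elim
      (auto simp: \<psi>s_def hm(3) intro!: tendsto_intros smear_cdf_conv[OF hm(1,2)])
  ultimately show ?thesis by (rule that)
qed

lemma F_conv_AE:
  assumes "\<phi> \<in> F_set \<phi>0 \<phi>1" "\<And>n. \<phi>s n \<in> F_set \<phi>0 \<phi>1" "F_conv \<phi>0 \<phi>s \<phi>"
  shows "AE x in lebesgue_on {0..1}. (\<lambda>n. \<phi>s n x) \<longlonglongrightarrow> \<phi> x"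
proof -
  note hm = has_measureD[OF F_set_has_measure(1)[OF assms(1)]]
  note hms = has_measureD[OF F_set_has_measure(1)[OF assms(2)]]
  show ?thesis
    using AE_no_atom[OF hm(1)] AE_space
  proof eventually_elim
    case (elim x)
    then have x: "x \<in> {0..1}" by simp
    have "(\<lambda>n. measure (dmeas \<phi>0 (\<phi>s n)) {0..x}) \<longlonglongrightarrow> measure (dmeas \<phi>0 \<phi>) {0..x}"
      using assms(3) elim x
      by (intro weak_conv_imp_cdf_conv hm(1,2) hms(1,2)) (auto simp: F_conv_def)
    then show ?case
      by (simp add: hm(3)[OF x] hms(3)[OF x] tendsto_add)
  qed
qed

section \<open>Passing to the limit in the minimality inequality\<close>

theorem theorem2p7:
  fixes \<phi>0 \<phi>1 :: real and \<rho> :: "real \<Rightarrow> real" and \<phi>\<epsilon> :: "real \<Rightarrow> real \<Rightarrow> real"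
    and \<epsilon> :: "nat \<Rightarrow> real" and \<phi> :: "real \<Rightarrow> real"
  assumes "\<phi>0 < \<phi>1"
    and "\<rho> \<in> M_set"
    and "\<And>e. e \<in> {0<..<1 / (\<phi>1 - \<phi>0)} \<Longrightarrow> \<phi>\<epsilon> e \<in> F_eps_min \<phi>0 \<phi>1 e \<rho>"
    and "\<And>n. \<epsilon> n \<in> {0<..<1 / (\<phi>1 - \<phi>0)}"
    and "decseq \<epsilon>"
    and "\<epsilon> \<longlonglongrightarrow> 0"
    and "\<phi> \<in> F_set \<phi>0 \<phi>1"
    and "F_conv \<phi>0 (\<lambda>n. \<phi>\<epsilon> (\<epsilon> n)) \<phi>"
  shows "is_arg_min (G_lim \<rho>) (\<lambda>\<psi>. \<psi> \<in> F_set \<phi>0 \<phi>1) \<phi>"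
proof -
  define m where "m = \<phi>1 - \<phi>0"
  have m: "0 < m" using assms(1) by (simp add: m_def)
  \<comment> \<open>The mean \<open>\<epsilon> n * m\<close> of the scaled density must lie strictly
    inside (0,1) for the tangent line used in Jensen's inequality.\<close>
  have \<epsilon>: "0 < \<epsilon> n" "0 < \<epsilon> n * m" "\<epsilon> n * m < 1" for n
    using assms(4)[of n] m by (auto simp: m_def[symmetric] field_simps)
  define \<phi>s where "\<phi>s n = \<phi>\<epsilon> (\<epsilon> n)" for n
  have "\<phi>s n \<in> F_eps_min \<phi>0 \<phi>1 (\<epsilon> n) \<rho>" for n
    unfolding \<phi>s_def by (intro assms(3,4))
  then have \<phi>s: "\<phi>s n \<in> F_set \<phi>0 \<phi>1"
    and min: "\<psi> \<in> F_set \<phi>0 \<phi>1 \<Longrightarrow> G_eps \<phi>0 (\<epsilon> n) \<rho> (\<phi>s n) \<le> G_eps \<phi>0 (\<epsilon> n) \<rho> \<psi>" for n \<psi>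
    by (auto simp: F_eps_min_def is_arg_min_def not_less)
  have conv: "(\<lambda>n. energy \<rho> (\<phi>s n)) \<longlonglongrightarrow> energy \<rho> \<phi>"
    using assms(8) by (intro energy_tendsto[OF assms(2,7) \<phi>s] F_conv_AE[OF assms(7) \<phi>s]) (simp add: \<phi>s_def)
  have "(\<lambda>n. \<epsilon> n * m) \<longlonglongrightarrow> 0"
    using tendsto_mult_right[OF assms(6), of m] by simp
  \<comment> \<open>The entropy limit is one-sided, so the positivity of
    \<open>\<epsilon> n * m\<close> enters here.\<close>
  then have "filterlim (\<lambda>n. \<epsilon> n * m) (at_right 0) sequentially"
    using \<epsilon>(2) by (intro tendsto_imp_filterlim_at_right) auto
  then have ent: "(\<lambda>n. bin_entropy (\<epsilon> n * m)) \<longlonglongrightarrow> 0"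
    by (rule filterlim_compose[OF bin_entropy_tendsto_0])
  have step: "energy \<rho> \<phi> \<le> energy \<rho> \<psi>"
    if \<psi>: "\<psi> \<in> F_set \<phi>0 \<phi>1" "absolutely_continuous lborel01 (dmeas \<phi>0 \<psi>)"
      and K: "AE x in lborel01. density_x \<phi>0 \<psi> x \<le> K" for \<psi> K
  proof -
    \<comment> \<open>Taking \<open>max K 1\<close> keeps the threshold positive whatever the sign
      of \<open>K\<close>; below it the competitor is admissible.\<close>
    have "eventually (\<lambda>n. \<epsilon> n < 1 / max K 1) sequentially"
      by (rule order_tendstoD(2)[OF assms(6)]) simp
    then have "eventually (\<lambda>n. energy \<rho> (\<phi>s n) + bin_entropy (\<epsilon> n * m) \<le> energy \<rho> \<psi>) sequentially"
    proof eventually_elim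
      case (elim n)
      have "\<epsilon> n * max K 1 \<le> 1"
        using elim by (intro less_imp_le) (simp add: less_divide_eq)
      then have "max K 1 \<le> 1 / \<epsilon> n"
        by (simp only: pos_le_divide_eq[OF \<epsilon>(1)] mult.commute)
      then have K': "AE x in lborel01. density_x \<phi>0 \<psi> x \<le> 1 / \<epsilon> n"
        using K by (auto elim!: eventually_mono)
      have G\<psi>: "G_eps \<phi>0 (\<epsilon> n) \<rho> \<psi> = ereal (energy \<rho> \<psi> + mix_entropy \<phi>0 (\<epsilon> n) \<psi>)"
        by (rule G_eps_eq_energy[OF assms(2) \<psi> \<epsilon>(1) K'])
      \<comment> \<open>The competitor has finite value, so the minimizer has a value below
        \<open>\<infinity>\<close> and is itself admissible.\<close>
      then have "G_eps \<phi>0 (\<epsilon> n) \<rho> (\<phi>s n) \<noteq> \<infinity>"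
        using min[OF \<psi>(1), of n] by auto
      then have ac: "absolutely_continuous lborel01 (dmeas \<phi>0 (\<phi>s n))"
        and bd: "AE x in lborel01. density_x \<phi>0 (\<phi>s n) x \<le> 1 / \<epsilon> n"
        by (auto simp: G_eps_def split: if_splits)
      have "energy \<rho> (\<phi>s n) + bin_entropy (\<epsilon> n * m) \<le> energy \<rho> (\<phi>s n) + mix_entropy \<phi>0 (\<epsilon> n) (\<phi>s n)"
        using mix_entropy_ge[OF \<epsilon>(1) bd \<phi>s ac \<epsilon>(2,3)[unfolded m_def]] by (simp add: m_def)
      also have "\<dots> \<le> energy \<rho> \<psi> + mix_entropy \<phi>0 (\<epsilon> n) \<psi>"
        using min[OF \<psi>(1), of n] unfolding G\<psi> G_eps_eq_energy[OF assms(2) \<phi>s ac \<epsilon>(1) bd] by simp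
      also have "\<dots> \<le> energy \<rho> \<psi>"
        using mix_entropy_nonpos[OF \<epsilon>(1) K'] by simp
      finally show ?case .
    qed
    moreover have "(\<lambda>n. energy \<rho> (\<phi>s n) + bin_entropy (\<epsilon> n * m)) \<longlonglongrightarrow> energy \<rho> \<phi>"
      using tendsto_add[OF conv ent] by simp
    ultimately show ?thesis
      by (intro tendsto_upperbound) auto
  qed
  have "energy \<rho> \<phi> \<le> energy \<rho> \<psi>" if \<psi>: "\<psi> \<in> F_set \<phi>0 \<phi>1" for \<psi>
  proof -
    obtain \<psi>s where \<psi>s: "\<And>n. \<psi>s n \<in> F_set \<phi>0 \<phi>1"
      "\<And>n. absolutely_continuous lborel01 (dmeas \<phi>0 (\<psi>s n))"
      "\<And>n. \<exists>K. AE x in lborel01. density_x \<phi>0 (\<psi>s n) x \<le> K"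
      "AE x in lebesgue_on {0..1}. (\<lambda>n. \<psi>s n x) \<longlonglongrightarrow> \<psi> x"
      using F_set_bounded_density_approx[OF \<psi>] by blast
    \<comment> \<open>The density bound may grow with \<open>n\<close>: the limit in
      \<open>\<epsilon>\<close> has already been taken for each fixed competitor.\<close>
    have "energy \<rho> \<phi> \<le> energy \<rho> (\<psi>s n)" for n
      using step[OF \<psi>s(1,2)] \<psi>s(3)[of n] by blast
    then show ?thesis
      by (intro LIMSEQ_le_const[OF energy_tendsto[OF assms(2) \<psi> \<psi>s(1,4)]]) auto
  qed
  then show ?thesis
    using assms(2,7) by (auto simp: is_arg_min_def G_lim_eq_energy not_less)
qed

end
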